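(* There are infinitely many pairs $(c,d)$ of square numbers such that $c \mid d$ and each of $c$ and $d$ is constructed by putting together two square numbers neither of which is divisible by $10$; that is, there exist square numbers $u_1,v_1,u_2,v_2$, none of them divisible by $10$, with $c = u_1\cdot 10^{m_1}+v_1$ and $d=u_2\cdot 10^{m_2}+v_2$, where $m_i$ is the number of decimal digits of $v_i$ for $i=1,2$.
   Context: A square number is an integer of the form $n^2$ with $n$ a positive integer. A number $N$ is "constructed by putting two square numbers $u$ and $v$ together" if the decimal expansion of $N$ is the concatenation of the decimal expansion of $u$ followed by that of $v$, i.e. $N=u\cdot 10^{m}+v$, where $m$ is the number of decimal digits of $v$ (for example, $4$ and $9$ put together give $49$). *)

theory Defs
  imports Complex_Main "HOL-Library.Log_Nat"
begin

definition square_number :: "nat \<Rightarrow> bool" where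
  "square_number N \<longleftrightarrow> (\<exists>n>0. N = n\<^sup>2)"

(* For v > 0, floorlog 10 v = \<lfloor>log 10 v\<rfloor> + 1 is the number of decimal digits of v
   (floorlog 10 0 = 0, but only positive v occur below). *)
definition put_together :: "nat \<Rightarrow> nat \<Rightarrow> nat" where
  "put_together u v = u * 10 ^ floorlog 10 v + v"

lemma put_together_4_9: "put_together 4 9 = 49"
  by (simp add: put_together_def compute_floorlog)

lemma put_together_16_81: "put_together 16 81 = 1681"
  by (simp add: put_together_def compute_floorlog)

definition constructed_from_two_squares :: "nat \<Rightarrow> bool" where
  "constructed_from_two_squares N \<longleftrightarrow>
    (\<exists>u v. square_number u \<and> square_number v \<and> \<not> 10 dvd u \<and> \<not> 10 dvd v \<and>
           N = put_together u v)"

end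

theory Submission
  imports Defs "HOL-Number_Theory.Residues"
begin

text \<open>
  The identity behind everything is the Pythagorean triple
  \<open>(2a(a+1))\<^sup>2 + (2a+1)\<^sup>2 = (2a\<^sup>2+2a+1)\<^sup>2\<close>, whose hypotenuse exceeds a leg by one. If \<open>2(a+1)\<close> is
  the power \<open>10^(k+1)\<close>, that is, \<open>a = 5\<cdot>10^k - 1 = 49\<dots>9\<close>, then the first summand is
  \<open>a\<^sup>2 \<cdot> 10^(2k+2)\<close>, while \<open>2a+1 = 10^(k+1) - 1 = 9\<dots>9\<close> has a square with exactly \<open>2k+2\<close> digits.
  So the square of \<open>r k = 2a\<^sup>2+2a+1\<close> is \<open>a\<^sup>2\<close> followed by \<open>(2a+1)\<^sup>2\<close>:
  \<open>41\<^sup>2 = 16|81\<close>, \<open>4901\<^sup>2 = 2401|9801\<close>, and so on.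

  For divisibility, note that \<open>r k\<close> is a polynomial in \<open>10^k\<close> and ends in the digit 1, so it is
  coprime to 10. Raising the exponent \<open>k\<close> by \<open>\<phi>(r k)\<close> does not change \<open>10^k\<close> modulo \<open>r k\<close>, by
  Euler's theorem, hence does not change the value of the polynomial modulo \<open>r k\<close>, which is 0. So \<open>r k\<close> divides
  \<open>r (k + \<phi>(r k))\<close>. Since \<open>\<phi>(r k) > 0\<close>, these are pairs of distinct squares, and \<open>c = (r k)\<^sup>2\<close>
  takes a new value for each \<open>k\<close>.
\<close>

definition head_root :: "nat \<Rightarrow> nat" where
  "head_root k = 5 * 10 ^ k - 1"

definition triple_hypotenuse :: "nat \<Rightarrow> nat" where
  "triple_hypotenuse a = 2 * a\<^sup>2 + 2 * a + 1"

lemma Suc_head_root: "head_root k + 1 = 5 * 10 ^ k"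
  by (simp add: head_root_def)

lemma head_root_pos: "head_root k > 0"
proof -
  have "(1::nat) \<le> 10 ^ k" by simp
  then show ?thesis using Suc_head_root[of k] by linarith
qed

lemma triple_hypotenuse_square:
  "(triple_hypotenuse a)\<^sup>2 = a\<^sup>2 * (2 * (a + 1))\<^sup>2 + (2 * a + 1)\<^sup>2"
  unfolding triple_hypotenuse_def by (simp add: power2_eq_square algebra_simps)

text \<open>
  Both bounds come from \<open>9 \<cdot> 10^k \<le> 10^(k+1) - 1 < 10^(k+1)\<close>; squaring the lower one gives
  \<open>81 \<cdot> 10^(2k)\<close>, which already has \<open>2k+2\<close> digits.
\<close>

lemma floorlog_repnine_square:
  assumes "b + 1 = 10 ^ (k + 1)"
  shows "floorlog 10 (b\<^sup>2) = 2 * k + 2"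
proof -
  define t :: nat where "t = 10 ^ k"
  have t: "t \<ge> 1" and b: "b + 1 = 10 * t"
    using assms by (simp_all add: t_def)
  have "(9 * t)\<^sup>2 \<le> b\<^sup>2" "b\<^sup>2 < (10 * t)\<^sup>2"
    using t b by (intro power_mono power_strict_mono; linarith)+
  moreover have "(10::nat) ^ (2 * k + 1) = 10 * t\<^sup>2" "(10::nat) ^ (2 * k + 2) = (10 * t)\<^sup>2"
    by (simp_all add: t_def power_mult power_mult_distrib power2_eq_square
        flip: power_mult_distrib power_add mult_2)
  ultimately have "10 ^ (2 * k + 1) \<le> b\<^sup>2" "b\<^sup>2 < 10 ^ (2 * k + 2)"
    by (simp_all add: power_mult_distrib)
  then show ?thesis
    using floorlog_leI[of "b\<^sup>2" 10 "2 * k + 2"] floorlog_ge_SucI[of 10 "2 * k + 1" "b\<^sup>2"] by simp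
qed

lemma constructed_triple_hypotenuse_square:
  "constructed_from_two_squares ((triple_hypotenuse (head_root k))\<^sup>2)"
proof -
  define a where "a = head_root k"
  have a: "a + 1 = 5 * 10 ^ k"
    unfolding a_def by (rule Suc_head_root)
  then have b: "(2 * a + 1) + 1 = 10 ^ (k + 1)"
    by simp
  have "coprime a 5"
    using a by (metis coprime_Suc_right_nat coprime_mult_right_iff Suc_eq_plus1)
  moreover have "coprime (2 * a + 1) 10"
    using coprime_Suc_right_nat[of "2 * a + 1"] unfolding Suc_eq_plus1 b by simp
  ultimately have "\<not> 5 dvd a\<^sup>2" "\<not> 10 dvd (2 * a + 1)\<^sup>2"
    using coprime_common_divisor_nat[of "a\<^sup>2" 5 5]
      coprime_common_divisor_nat[of "(2 * a + 1)\<^sup>2" 10 10]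
    by auto
  moreover from this have "\<not> 10 dvd a\<^sup>2"
    using dvd_trans[of 5 10 "a\<^sup>2"] by fastforce
  moreover have "(triple_hypotenuse a)\<^sup>2 = put_together (a\<^sup>2) ((2 * a + 1)\<^sup>2)"
  proof -
    have "(2 * (a + 1))\<^sup>2 = (10 ^ (k + 1))\<^sup>2"
      using b by simp
    also have "\<dots> = 10 ^ (2 * k + 2)"
      by (simp flip: power_mult)
    finally show ?thesis
      unfolding put_together_def floorlog_repnine_square[OF b] triple_hypotenuse_square by simp
  qed
  moreover have "square_number (a\<^sup>2)" "square_number ((2 * a + 1)\<^sup>2)"
    using head_root_pos[of k] unfolding square_number_def a_def by (blast, fastforce)
  ultimately show ?thesis
    unfolding constructed_from_two_squares_def a_def by blast
qed

lemma coprime_10_triple_hypotenuse: "coprime 10 (triple_hypotenuse (head_root k))"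
proof -
  have "triple_hypotenuse (head_root k) = 2 * (head_root k + 1) * head_root k + 1"
    by (simp add: triple_hypotenuse_def power2_eq_square algebra_simps)
  also have "\<dots> = 10 * (10 ^ k * head_root k) + 1"
    by (simp only: Suc_head_root)
  finally have *: "triple_hypotenuse (head_root k) = 10 * (10 ^ k * head_root k) + 1" .
  have "coprime (10 * (10 ^ k * head_root k)) (triple_hypotenuse (head_root k))"
    unfolding * Suc_eq_plus1[symmetric] by (rule coprime_Suc_right_nat)
  then show ?thesis
    by (simp only: coprime_mult_left_iff)
qed

lemma triple_hypotenuse_dvd:
  fixes k
  defines "n \<equiv> triple_hypotenuse (head_root k)"
  shows "n dvd triple_hypotenuse (head_root (k + totient n))"
proof -
  have "[10 ^ totient n = 1] (mod n)"
    using euler_theorem coprime_10_triple_hypotenuse unfolding n_def by blast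
  then have "[5 * 10 ^ k * 10 ^ totient n = 5 * 10 ^ k * 1] (mod n)"
    by (rule cong_scalar_left)
  then have "[head_root (k + totient n) + 1 = head_root k + 1] (mod n)"
    by (simp only: Suc_head_root power_add mult.assoc mult_1_right)
  then have "[head_root (k + totient n) = head_root k] (mod n)"
    by (simp only: cong_add_rcancel_nat)
  then have "[triple_hypotenuse (head_root (k + totient n)) = n] (mod n)"
    unfolding triple_hypotenuse_def n_def
    by (intro cong_add cong_mult cong_pow cong_refl)
  then show ?thesis
    by (simp add: cong_def mod_eq_0_iff_dvd)
qed

lemma inj_triple_hypotenuse_square: "inj (\<lambda>k. (triple_hypotenuse (head_root k))\<^sup>2)"
proof (rule strict_mono_imp_inj_on, rule strict_monoI)
  fix j k :: nat
  assume "j < k"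
  then have "(10::nat) ^ j < 10 ^ k" by simp
  then have "head_root j < head_root k"
    using Suc_head_root[of j] Suc_head_root[of k] by linarith
  then have "triple_hypotenuse (head_root j) < triple_hypotenuse (head_root k)"
    unfolding triple_hypotenuse_def by (simp add: add_strict_mono power_strict_mono)
  then show "(triple_hypotenuse (head_root j))\<^sup>2 < (triple_hypotenuse (head_root k))\<^sup>2"
    by (simp add: power_strict_mono)
qed

theorem theorem2p2:
  shows "infinite {(c, d). square_number c \<and> square_number d \<and> c dvd d \<and>
           constructed_from_two_squares c \<and> constructed_from_two_squares d}"
    (is "infinite ?S")
proof -
  define r where "r k = triple_hypotenuse (head_root k)" for k
  have "square_number ((r k)\<^sup>2)" for k
    unfolding square_number_def r_def triple_hypotenuse_def by fastforce
  moreover have "(r k)\<^sup>2 dvd (r (k + totient (r k)))\<^sup>2" for k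
    using triple_hypotenuse_dvd[of k] by (simp add: r_def)
  ultimately have "range (\<lambda>k. ((r k)\<^sup>2, (r (k + totient (r k)))\<^sup>2)) \<subseteq> ?S"
    using constructed_triple_hypotenuse_square by (auto simp: r_def)
  moreover have "inj (\<lambda>k. ((r k)\<^sup>2, (r (k + totient (r k)))\<^sup>2))"
    using inj_triple_hypotenuse_square by (auto simp: inj_def r_def)
  ultimately show ?thesis
    using range_inj_infinite infinite_super by blast
qed

end
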